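(* Let $n_{C_1},n_{C_2}\ge1$ be integers with $n_{C_1}+n_{C_2}=n_C$ and $n_{I_1},n_{I_2}\geq1$ integers with $n_{I_1}+n_{I_2}=n_I$. Put $\beta_C=n_{C_1}/n_{C_2}\geq 1$ and $\beta=n_{I_1}/n_{I_2}$, and suppose $1\le\beta<2p-1$ and $$\frac{2\beta n_I-\beta-1}{2n_I+\beta+1}<\beta_C<\frac{2\beta n_I+\beta+1}{2n_I-\beta-1}.$$ Then for all sufficiently large $g$ the system $\dot{\mathbf x}=F(\mathbf x,g):=-\mathbf x+\frac1{\sqrt N}H\tanh(g\mathbf x)$ on $\mathbb R^N$ has a fixed point $\mathbf x^*(g)$ in which all cells of $n_{C_1}$ of the excitatory clusters have common activity $x_{E_1}(g)$, all cells of the other $n_{C_2}$ excitatory clusters have common activity $x_{E_2}(g)$, $n_{I_1}$ of the inhibitory cells have common activity $x_{I_1}(g)$, and the other $n_{I_2}$ inhibitory cells have common activity $x_{I_2}(g)$, such that as $g\to\infty$, $(x_{E_1},x_{E_2},x_{I_1},x_{I_2})\to(\hat x_{E_1},\hat x_{E_2},\hat x_{I_1},\hat x_{I_2})$ with $\hat x_{E_1},\hat x_{I_1}>0$ and $\hat x_{E_2},\hat x_{I_2}<0$. Moreover this fixed point is stable for all sufficiently large $g$, i.e. all eigenvalues of the Jacobian $DF(\mathbf x^*(g))$ have negative real part.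
   Context: Let $n_C,n_I\ge 2$ and $p>1$ be integers, $n_E=p\,n_C$, $N=n_E+n_I$, $f=n_E/N$, $\alpha=\frac{f}{1-f}$ (so $\alpha n_I=p n_C$), with $n_C\ge\alpha$, and let $\mu>0$. The function $\tanh$ acts on vectors componentwise. $\mathbf 1_{m\times n}$ is the all-ones matrix and $\mathbf K_n=\mathbf 1_{n\times n}-\mathbf I_n$, with $\mathbf I_n$ the identity. The connectivity matrix ($n_C$ excitatory clusters of $p$ cells each, one inhibitory cluster of $n_I$ cells, balanced weights) is $$H=\begin{bmatrix}A & -\alpha\mu\,\mathbf 1_{n_E\times n_I}\\ \mu\,\mathbf 1_{n_I\times n_E} & -\alpha\mu\,\mathbf K_{n_I}\end{bmatrix},$$ where $A$ is block diagonal with $n_C$ diagonal blocks (the excitatory clusters), each equal to $n_C\mu\,\mathbf K_p$. The Jacobian is $DF(\mathbf x^* )=\frac{g}{\sqrt N}H\,\mathrm{diag}(\operatorname{sech}^2(g\mathbf x^* ))-\mathbf I_N$. *)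

theory Defs
  imports Complex_Main "Jordan_Normal_Form.Char_Poly"
begin

definition ones_mat :: "nat \<Rightarrow> nat \<Rightarrow> real mat" where
  "ones_mat m n = mat m n (\<lambda>_. 1)"

definition K_mat :: "nat \<Rightarrow> real mat" where
  "K_mat n = ones_mat n n - 1\<^sub>m n"

definition f_frac :: "nat \<Rightarrow> nat \<Rightarrow> nat \<Rightarrow> real" where
  "f_frac p n_C n_I = real (p * n_C) / real (p * n_C + n_I)"

definition alpha :: "nat \<Rightarrow> nat \<Rightarrow> nat \<Rightarrow> real" where
  "alpha p n_C n_I = f_frac p n_C n_I / (1 - f_frac p n_C n_I)"

definition exc_block :: "nat \<Rightarrow> nat \<Rightarrow> real \<Rightarrow> real mat" where
  "exc_block p n_C \<mu> = diag_block_mat (replicate n_C ((real n_C * \<mu>) \<cdot>\<^sub>m K_mat p))"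

(* Cells are numbered from 0: the excitatory cells 0, ..., p * n_C - 1 come first, cell i of them
   lying in cluster i div p; they are followed by the n_I inhibitory cells. *)
definition conn_mat :: "nat \<Rightarrow> nat \<Rightarrow> nat \<Rightarrow> real \<Rightarrow> real mat" where
  "conn_mat p n_C n_I \<mu> =
     four_block_mat
       (exc_block p n_C \<mu>)            ((- alpha p n_C n_I * \<mu>) \<cdot>\<^sub>m ones_mat (p * n_C) n_I)
       (\<mu> \<cdot>\<^sub>m ones_mat n_I (p * n_C))  ((- alpha p n_C n_I * \<mu>) \<cdot>\<^sub>m K_mat n_I)"

definition vec_field :: "nat \<Rightarrow> real mat \<Rightarrow> real vec \<Rightarrow> real \<Rightarrow> real vec" where
  "vec_field N H x g = - x + (1 / sqrt (real N)) \<cdot>\<^sub>v (H *\<^sub>v map_vec tanh (g \<cdot>\<^sub>v x))"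

definition fixed_point :: "nat \<Rightarrow> real mat \<Rightarrow> real \<Rightarrow> real vec \<Rightarrow> bool" where
  "fixed_point N H g x \<longleftrightarrow> x \<in> carrier_vec N \<and> vec_field N H x g = 0\<^sub>v N"

definition sech :: "real \<Rightarrow> real" where
  "sech t = 1 / cosh t"

definition jacobian :: "nat \<Rightarrow> real mat \<Rightarrow> real \<Rightarrow> real vec \<Rightarrow> real mat" where
  "jacobian N H g x =
     (g / sqrt (real N)) \<cdot>\<^sub>m
       (H * mat_diag N (\<lambda>i. (sech (g * x $ i))\<^sup>2)) - 1\<^sub>m N"

(* The eigenvalues of the real Jacobian are taken in the complex numbers. *)
definition stable_at :: "nat \<Rightarrow> real mat \<Rightarrow> real \<Rightarrow> real vec \<Rightarrow> bool" where
  "stable_at N H g x \<longleftrightarrow>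
     (\<forall>k. eigenvalue (map_mat complex_of_real (jacobian N H g x)) k \<longrightarrow> Re k < 0)"

(* C1 is the set of excitatory clusters with activity xE1 (the others have xE2); I1 is the set of
   inhibitory cells, numbered from 0 within the inhibitory population, with activity xI1 (the
   others have xI2). *)
definition cluster_state ::
  "nat \<Rightarrow> nat \<Rightarrow> nat \<Rightarrow> nat set \<Rightarrow> nat set \<Rightarrow> real \<Rightarrow> real \<Rightarrow> real \<Rightarrow> real \<Rightarrow> real vec" where
  "cluster_state p n_C n_I C1 I1 xE1 xE2 xI1 xI2 =
     vec (p * n_C + n_I) (\<lambda>i.
       if i < p * n_C then (if i div p \<in> C1 then xE1 else xE2)
       else (if i - p * n_C \<in> I1 then xI1 else xI2))"

lemma conn_mat_carrier: "conn_mat p n_C n_I \<mu> \<in> carrier_mat (p * n_C + n_I) (p * n_C + n_I)"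
proof -
  have "exc_block p n_C \<mu> \<in> carrier_mat (p * n_C) (p * n_C)"
    by (rule carrier_matI)
       (simp_all add: exc_block_def dim_diag_block_mat sum_list_replicate K_mat_def ones_mat_def)
  then show ?thesis
    unfolding conn_mat_def
    by (rule four_block_carrier_mat) (rule carrier_matI, simp_all add: K_mat_def ones_mat_def)
qed

lemma alpha_eq:
  assumes "n_I > 0"
  shows "alpha p n_C n_I = real (p * n_C) / real n_I"
proof -
  define S where "S = real (p * n_C + n_I)"
  have S: "S \<noteq> 0" "S = real (p * n_C) + real n_I"
    using assms unfolding S_def by linarith+
  have f: "f_frac p n_C n_I = real (p * n_C) / S"
    by (simp add: f_frac_def S_def)
  have "1 - f_frac p n_C n_I = real n_I / S"
    unfolding f using S by (simp add: divide_simps del: of_nat_mult)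
  then show ?thesis
    unfolding alpha_def f using S(1) by simp
qed

lemma exc_block_index:
  assumes "i < p * n_C" "j < p * n_C"
  shows "exc_block p n_C \<mu> $$ (i, j) =
    (if i div p = j div p \<and> i \<noteq> j then real n_C * \<mu> else 0)"
proof -
  have dim: "diag_block_mat (replicate n (c \<cdot>\<^sub>m K_mat p)) \<in> carrier_mat (p * n) (p * n)" for n c
    by (rule carrier_matI)
       (simp_all add: dim_diag_block_mat sum_list_replicate K_mat_def ones_mat_def)
  have "i < p * n \<Longrightarrow> j < p * n \<Longrightarrow>
    diag_block_mat (replicate n (c \<cdot>\<^sub>m K_mat p)) $$ (i, j) =
      (if i div p = j div p \<and> i \<noteq> j then c else 0)" for n c i j
  proof (induction n arbitrary: i j)
    case 0
    then show ?case by simp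
  next
    case (Suc n)
    have p: "p > 0" using Suc.prems by (cases p) auto
    let ?D = "diag_block_mat (replicate n (c \<cdot>\<^sub>m K_mat p))"
    have K: "dim_row (c \<cdot>\<^sub>m K_mat p) = p" "dim_col (c \<cdot>\<^sub>m K_mat p) = p"
      by (simp_all add: K_mat_def ones_mat_def)
    have D: "dim_row ?D = p * n" "dim_col ?D = p * n" using dim by auto
    have shift: "k div p = Suc ((k - p) div p)" if "\<not> k < p" for k
      using that p by (simp add: le_div_geq)
    have z: "k div p = 0 \<longleftrightarrow> k < p" for k using p by (simp add: div_eq_0_iff)
    have E: "diag_block_mat (replicate (Suc n) (c \<cdot>\<^sub>m K_mat p)) $$ (i, j) =
      (if i < p then if j < p then (c \<cdot>\<^sub>m K_mat p) $$ (i, j) else 0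
       else if j < p then 0 else ?D $$ (i - p, j - p))"
      using Suc.prems by (auto simp: Let_def K D simp del: index_smult_mat)
    show ?case
      using Suc.prems Suc.IH[of "i - p" "j - p"] unfolding E
      by (auto simp: shift z K_mat_def ones_mat_def)
  qed
  then show ?thesis
    using assms unfolding exc_block_def by blast
qed

lemma jacobian_index:
  assumes "H \<in> carrier_mat N N" "i < N" "j < N"
  shows "jacobian N H g x $$ (i, j) =
    g / sqrt (real N) * (H $$ (i, j) * (sech (g * x $ j))\<^sup>2) - (if i = j then 1 else 0)"
proof -
  show ?thesis
    using assms by (simp add: jacobian_def mat_diag_mult_right[OF assms(1)] mat_diag_dim)
qed

(* The entries of jacobian are the partial derivatives of vec_field. *)
lemma vec_field_partial_derivative:
  assumes H: "H \<in> carrier_mat N N" and x: "x \<in> carrier_vec N" and i: "i < N" and j: "j < N"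
  shows "((\<lambda>t. vec_field N H (vec N (\<lambda>k. if k = j then t else x $ k)) g $ i)
    has_real_derivative jacobian N H g x $$ (i, j)) (at (x $ j))"
proof -
  let ?y = "\<lambda>t k. if k = j then t else x $ k"
  have F: "vec_field N H (vec N (?y t)) g $ i =
      - ?y t i + 1 / sqrt (real N) * (\<Sum>k = 0..<N. H $$ (i, k) * tanh (g * ?y t k))" for t
    using H i by (simp add: vec_field_def scalar_prod_def)
  have sech: "1 - (tanh u)\<^sup>2 = (sech u)\<^sup>2" for u :: real
    using hyperbolic_pythagoras[of u] by (simp add: sech_def tanh_def power_divide divide_simps)
  have T: "((\<lambda>t. tanh (g * t)) has_real_derivative g * (sech (g * x $ j))\<^sup>2) (at (x $ j))"
    by (rule derivative_eq_intros refl | simp add: sech)+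
  have D: "((\<lambda>t. H $$ (i, k) * tanh (g * ?y t k)) has_real_derivative
      (if k = j then H $$ (i, j) * (g * (sech (g * x $ j))\<^sup>2) else 0)) (at (x $ j))" for k
    using DERIV_cmult[OF T, of "H $$ (i, j)"] by simp
  have S: "((\<lambda>t. \<Sum>k = 0..<N. H $$ (i, k) * tanh (g * ?y t k)) has_real_derivative
      (\<Sum>k = 0..<N. if k = j then H $$ (i, j) * (g * (sech (g * x $ j))\<^sup>2) else 0)) (at (x $ j))"
    by (rule DERIV_sum) (rule D)
  have Y: "((\<lambda>t. - ?y t i) has_real_derivative - (if i = j then 1 else 0)) (at (x $ j))"
    by (auto intro!: derivative_eq_intros)
  show ?thesis
    unfolding F jacobian_index[OF H i j]
    by (rule DERIV_cong[OF DERIV_add[OF Y DERIV_cmult[OF S]]]) (use j in simp)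
qed

end

theory Submission
  imports "HOL-Analysis.Brouwer_Fixpoint" "HOL-Analysis.Cartesian_Euclidean_Space" Defs
begin

text \<open>
  As \<open>g \<rightarrow> \<infinity>\<close> the function \<open>tanh (g * _)\<close> converges to the sign function, uniformly away from \<open>0\<close>.
  The bounds on \<open>\<beta>\<close> and \<open>\<beta>\<^sub>C\<close> make the sign pattern \<open>(+, -, +, -)\<close> reproduce itself under the
  saturated system. Brouwer's theorem on a box around the image of this pattern, whose
  radius tends to \<open>0\<close>, gives the fixed points. As their coordinates stay away from \<open>0\<close>,
  \<open>g * sech\<^sup>2 (g * x)\<close> tends to \<open>0\<close> and the Jacobian tends to \<open>- I\<close>.
\<close>

unbundle no vec_syntax

section \<open>Fixed points of a saturated \<open>tanh\<close> system\<close>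

text \<open>Since \<open>tanh\<close> is odd and increasing, the distance to the sign \<sigma> is
  largest where \<open>\<sigma> * y\<close> equals its lower bound \<open>m\<close>.\<close>

lemma tanh_near_sign:
  fixes y g m \<sigma> :: real
  assumes "\<bar>\<sigma>\<bar> = 1" "m \<le> \<sigma> * y" "0 \<le> g"
  shows "\<bar>tanh (g * y) - \<sigma>\<bar> \<le> 1 - tanh (g * m)"
proof -
  have "tanh (g * m) \<le> tanh (g * (\<sigma> * y))"
    using assms by (simp add: mult_left_mono)
  moreover have "\<bar>tanh (g * y) - \<sigma>\<bar> = 1 - tanh (g * (\<sigma> * y))"
  proof -
    consider "\<sigma> = 1" | "\<sigma> = -1" using assms(1) by linarith
    then show ?thesis
      using tanh_real_lt_1[of "g * y"] tanh_real_gt_neg1[of "g * y"] by cases auto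
  qed
  ultimately show ?thesis by linarith
qed

text \<open>The right-hand side maps the box of radius \<open>r\<close> around \<open>l\<close> into
  itself. In the box each coordinate keeps its sign with margin at least \<open>2 * m - r\<close>,
  hence at least \<open>m\<close>, so every \<open>tanh\<close> is within
  \<open>1 - tanh (g * m)\<close> of its sign, and a row of absolute sum at most \<open>C\<close>
  moves the image away from \<open>l i\<close> by at most \<open>r\<close>. Brouwer's theorem
  applies.\<close>

lemma saturated_box_fixed_point:
  fixes a :: "'n::finite \<Rightarrow> 'n \<Rightarrow> real" and \<sigma> l :: "'n \<Rightarrow> real"
  assumes \<sigma>: "\<And>j. \<bar>\<sigma> j\<bar> = 1"
    and l: "\<And>i. l i = (\<Sum>j\<in>UNIV. a i j * \<sigma> j)"
    and m: "\<And>j. 2 * m \<le> \<sigma> j * l j"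
    and C: "\<And>i. (\<Sum>j\<in>UNIV. \<bar>a i j\<bar>) \<le> C"
    and g: "0 \<le> g"
    and r: "r = C * (1 - tanh (g * m))" "r \<le> m"
  shows "\<exists>x. \<forall>i. x i = (\<Sum>j\<in>UNIV. a i j * tanh (g * x j)) \<and> \<bar>x i - l i\<bar> \<le> r"
proof -
  define f where "f x = vec_lambda (\<lambda>i. \<Sum>j\<in>UNIV. a i j * tanh (g * vec_nth x j))"
    for x :: "real ^ 'n"
  define S where "S = cbox (vec_lambda (\<lambda>i. l i - r)) (vec_lambda (\<lambda>i. l i + r))"
  have S: "x \<in> S \<longleftrightarrow> (\<forall>i. \<bar>vec_nth x i - l i\<bar> \<le> r)" for x
    unfolding S_def mem_box_cart by (simp add: abs_le_iff) (metis add.commute diff_le_eq le_diff_eq minus_diff_eq)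
  \<comment> \<open>Any row shows that \<open>C\<close> is nonnegative; then \<open>r\<close> is
    nonnegative and the box contains its centre \<open>l\<close>.\<close>
  have "0 \<le> (\<Sum>j\<in>UNIV. \<bar>a undefined j\<bar>)" by (simp add: sum_nonneg)
  then have "0 \<le> C" using C order_trans by blast
  then have r0: "0 \<le> r"
    unfolding r using tanh_real_lt_1[of "g * m"] by simp
  have "f x \<in> S" if "x \<in> S" for x
    unfolding S
  proof
    fix i
    have sat: "\<bar>tanh (g * vec_nth x j) - \<sigma> j\<bar> \<le> 1 - tanh (g * m)" for j
    proof (rule tanh_near_sign[OF \<sigma> _ g])
      have "\<sigma> j * l j - \<sigma> j * vec_nth x j \<le> \<bar>\<sigma> j\<bar> * \<bar>vec_nth x j - l j\<bar>"
        unfolding abs_mult[symmetric] by (simp add: algebra_simps)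
      also have "\<dots> \<le> m"
        using \<sigma>[of j] that r(2) unfolding S by (auto intro: order_trans)
      finally show "m \<le> \<sigma> j * vec_nth x j"
        using m[of j] by linarith
    qed
    \<comment> \<open>As \<open>l\<close> is the image of the sign vector, only the errors of
      \<open>tanh\<close> against the signs remain.\<close>
    have "vec_nth (f x) i - l i = (\<Sum>j\<in>UNIV. a i j * (tanh (g * vec_nth x j) - \<sigma> j))"
      by (simp add: f_def l sum_subtractf right_diff_distrib)
    also have "\<bar>\<dots>\<bar> \<le> (\<Sum>j\<in>UNIV. \<bar>a i j\<bar> * (1 - tanh (g * m)))"
      by (rule order_trans[OF sum_abs], rule sum_mono) (simp add: abs_mult mult_left_mono sat)
    also have "\<dots> \<le> r"
      unfolding r sum_distrib_right[symmetric]
      using C[of i] tanh_real_lt_1[of "g * m"] by (simp add: mult_right_mono)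
    finally show "\<bar>vec_nth (f x) i - l i\<bar> \<le> r" .
  qed
  moreover have "continuous_on S f"
    unfolding f_def
    by (intro continuous_intros continuous_on_vec_lambda) (auto simp: cosh_real_nonzero)
  moreover have "vec_lambda l \<in> S" using r0 by (simp add: S)
  ultimately obtain x where x: "x \<in> S" "f x = x"
    using brouwer[of S f] by (auto simp: S_def)
  have "vec_nth (f x) i = (\<Sum>j\<in>UNIV. a i j * tanh (g * vec_nth x j))" for i
    by (simp add: f_def)
  then show ?thesis
    using x unfolding S by metis
qed

lemma saturated_fixed_points:
  fixes a :: "'n::finite \<Rightarrow> 'n \<Rightarrow> real" and \<sigma> l :: "'n \<Rightarrow> real"
  assumes \<sigma>: "\<And>j. \<bar>\<sigma> j\<bar> = 1"
    and l: "\<And>i. l i = (\<Sum>j\<in>UNIV. a i j * \<sigma> j)"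
    and pos: "\<And>j. 0 < \<sigma> j * l j"
  obtains x where "\<forall>\<^sub>F g in at_top. \<forall>i. x g i = (\<Sum>j\<in>UNIV. a i j * tanh (g * x g j))"
    and "\<And>i. ((\<lambda>g. x g i) \<longlongrightarrow> l i) at_top"
proof -
  \<comment> \<open>Half of the smallest margin of \<open>l\<close>: the other half is what a box of
    radius at most \<open>m\<close> may use up.\<close>
  define m where "m = Min (range (\<lambda>j. \<sigma> j * l j)) / 2"
  define C where "C = (\<Sum>i\<in>UNIV. \<Sum>j\<in>UNIV. \<bar>a i j\<bar>)"
  define r where "r g = C * (1 - tanh (g * m))" for g
  define P where "P g x \<longleftrightarrow>
    (\<forall>i. x i = (\<Sum>j\<in>UNIV. a i j * tanh (g * x j)) \<and> \<bar>x i - l i\<bar> \<le> r g)" for g x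
  have m0: "0 < m"
    unfolding m_def using pos by simp
  have m2: "2 * m \<le> \<sigma> j * l j" for j
    unfolding m_def by simp
  have C: "(\<Sum>j\<in>UNIV. \<bar>a i j\<bar>) \<le> C" for i
    unfolding C_def by (rule member_le_sum) (simp_all add: sum_nonneg)
  have "filterlim (\<lambda>g. g * m) at_top at_top"
    using filterlim_tendsto_pos_mult_at_top[OF tendsto_const m0 filterlim_ident]
    by (simp add: mult.commute)
  then have "((\<lambda>g. tanh (g * m)) \<longlongrightarrow> 1) at_top"
    by (rule filterlim_compose[OF tanh_real_at_top])
  then have "(r \<longlongrightarrow> C * (1 - 1)) at_top"
    unfolding r_def[abs_def] by (intro tendsto_intros)
  then have r: "(r \<longlongrightarrow> 0) at_top" by simp
  then have "\<forall>\<^sub>F g in at_top. r g < m"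
    using m0 by (rule order_tendstoD)
  with eventually_ge_at_top[of 0] have "\<forall>\<^sub>F g in at_top. \<exists>x. P g x"
    by eventually_elim (unfold P_def, rule saturated_box_fixed_point[OF \<sigma> l m2 C _ r_def], auto)
  \<comment> \<open>One fixed point is chosen separately for each large \<open>g\<close>; its
    convergence to \<open>l\<close> comes from the shrinking radius \<open>r g\<close>
    alone.\<close>
  then obtain x where x: "\<forall>\<^sub>F g in at_top. P g (x g)"
    unfolding eventually_ex by blast
  show thesis
  proof
    show "\<forall>\<^sub>F g in at_top. \<forall>i. x g i = (\<Sum>j\<in>UNIV. a i j * tanh (g * x g j))"
      using x by (rule eventually_mono) (unfold P_def, blast)
    fix i
    have "\<forall>\<^sub>F g in at_top. norm (x g i - l i) \<le> r g"
      using x by (rule eventually_mono) (unfold P_def real_norm_def, blast)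
    then have "((\<lambda>g. x g i - l i) \<longlongrightarrow> 0) at_top"
      using r by (rule Lim_null_comparison)
    then show "((\<lambda>g. x g i) \<longlongrightarrow> l i) at_top"
      by (rule LIM_zero_cancel)
  qed
qed

section \<open>Stability at large gain\<close>

text \<open>This is a Gershgorin-type bound for \<open>A\<close> plus the identity: its eigenvalue
  \<open>k + 1\<close> is at most a row sum in modulus, so \<open>k\<close> lies in the open unit
  disc around -1.\<close>

lemma eigenvalue_Re_neg:
  fixes A :: "complex mat"
  assumes A: "A \<in> carrier_mat n n"
    and row: "\<And>i. i < n \<Longrightarrow> (\<Sum>j<n. cmod (A $$ (i, j) + (if i = j then 1 else 0))) < 1"
    and k: "eigenvalue A k"
  shows "Re k < 0"
proof -
  obtain v where v: "v \<in> carrier_vec n" "v \<noteq> 0\<^sub>v n" "A *\<^sub>v v = k \<cdot>\<^sub>v v"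
    using k A unfolding eigenvalue_def eigenvector_def by auto
  define M where "M = Max ((\<lambda>i. cmod (v $ i)) ` {..<n})"
  obtain i0 where i0: "i0 < n" "v $ i0 \<noteq> 0"
    using v(1,2) by (metis carrier_vecD eq_vecI index_zero_vec)
  have M: "cmod (v $ j) \<le> M" if "j < n" for j
    unfolding M_def using that by simp
  have "M \<in> (\<lambda>i. cmod (v $ i)) ` {..<n}"
    unfolding M_def using i0 by (intro Max_in) auto
  \<comment> \<open>The row used is one where the eigenvector has its largest modulus, so that all
    other components are bounded by \<open>M\<close>.\<close>
  then obtain i where i: "i < n" "cmod (v $ i) = M" by auto
  have "0 < M" using M[OF i0(1)] i0(2) by (smt (verit) zero_less_norm_iff)
  let ?d = "\<lambda>j. if i = j then 1 else 0"
  have "k * v $ i = (A *\<^sub>v v) $ i" using v i by simp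
  also have "\<dots> = (\<Sum>j<n. A $$ (i, j) * v $ j)"
    using A v(1) i(1) by (simp add: scalar_prod_def atLeast0LessThan)
  finally have "(k + 1) * v $ i = (\<Sum>j<n. A $$ (i, j) * v $ j) + (\<Sum>j<n. ?d j * v $ j)"
    using i(1) by (simp add: distrib_right if_distrib[of "\<lambda>c. c * _"] cong: if_cong)
  also have "\<dots> = (\<Sum>j<n. (A $$ (i, j) + ?d j) * v $ j)"
    by (simp add: distrib_right sum.distrib)
  finally have "cmod (k + 1) * M = cmod (\<Sum>j<n. (A $$ (i, j) + ?d j) * v $ j)"
    using i(2) by (metis norm_mult)
  also have "\<dots> \<le> (\<Sum>j<n. cmod (A $$ (i, j) + ?d j) * M)"
    by (rule sum_norm_le) (simp add: norm_mult M mult_left_mono)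
  also have "\<dots> < 1 * M"
    unfolding sum_distrib_right[symmetric] using row[OF i(1)] \<open>0 < M\<close> by (intro mult_strict_right_mono)
  finally have "cmod (k + 1) < 1" using \<open>0 < M\<close> by simp
  then show ?thesis
    using abs_Re_le_cmod[of "k + 1"] by simp
qed

text \<open>The quadratic decay of \<open>sech\<close> squared is enough: it leaves
  \<open>4 / (y g)\<^sup>2\<close> times \<open>1 / g\<close>, whose first factor converges because
  \<open>L\<close> is nonzero.\<close>

lemma gain_times_sech_sq_tendsto_0:
  assumes y: "(y \<longlongrightarrow> L) at_top" and L: "L \<noteq> 0"
  shows "((\<lambda>g::real. g * (sech (g * y g))\<^sup>2) \<longlongrightarrow> 0) at_top"
proof -
  have bound: "(sech u)\<^sup>2 \<le> 4 / u\<^sup>2" if "u \<noteq> 0" for u :: real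
  proof -
    \<comment> \<open>The chain
      \<open>\<bar>u\<bar> \<le> exp \<bar>u\<bar> \<le> 2 * cosh u\<close> is where the constant 4
      comes from.\<close>
    have "\<bar>u\<bar> \<le> exp \<bar>u\<bar>" using exp_ge_add_one_self[of "\<bar>u\<bar>"] by linarith
    also have "\<dots> \<le> 2 * cosh u"
      unfolding cosh_def by (cases "0 \<le> u") auto
    finally have "\<bar>u\<bar>\<^sup>2 \<le> (2 * cosh u)\<^sup>2" by (intro power_mono) auto
    then have "u\<^sup>2 \<le> 4 * (cosh u)\<^sup>2" by (simp add: power_mult_distrib)
    then show ?thesis
      using that by (simp add: sech_def power_divide divide_simps)
  qed
  have "\<forall>\<^sub>F g in at_top. y g \<noteq> 0"
    using tendsto_imp_eventually_ne[OF y L] .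
  with eventually_gt_at_top[of 0]
  have "\<forall>\<^sub>F g in at_top. norm (g * (sech (g * y g))\<^sup>2) \<le> 4 / (y g)\<^sup>2 * inverse g"
  proof eventually_elim
    case (elim g)
    then have "g * (sech (g * y g))\<^sup>2 \<le> g * (4 / (g * y g)\<^sup>2)"
      by (intro mult_left_mono bound) auto
    also have "\<dots> = 4 / (y g)\<^sup>2 * inverse g"
      using elim by (simp add: field_simps power2_eq_square)
    finally show ?case using elim by simp
  qed
  moreover have "((\<lambda>g. 4 / (y g)\<^sup>2 * inverse g) \<longlongrightarrow> 4 / L\<^sup>2 * 0) at_top"
    using L by (intro tendsto_intros y tendsto_inverse_0_at_top filterlim_ident) auto
  ultimately show ?thesis
    unfolding mult_zero_right by (rule Lim_null_comparison)
qed

text \<open>Each column of the Jacobian plus the identity carries a factor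
  \<open>g * sech\<^sup>2\<close> that tends to 0, so all of the finitely many absolute row sums
  eventually drop below 1.\<close>

lemma eventually_stable_at:
  assumes H: "H \<in> carrier_mat N N"
    and lim: "\<And>j. j < N \<Longrightarrow> ((\<lambda>g. x g $ j) \<longlongrightarrow> L j) at_top"
    and L: "\<And>j. j < N \<Longrightarrow> L j \<noteq> 0"
  shows "\<forall>\<^sub>F g in at_top. stable_at N H g (x g)"
proof -
  \<comment> \<open>These are the entries of the Jacobian plus the identity, with the vanishing
    factor split off.\<close>
  define b where "b g i j = H $$ (i, j) / sqrt (real N) * (g * (sech (g * x g $ j))\<^sup>2)" for g i j
  have "((\<lambda>g. \<Sum>j<N. \<bar>b g i j\<bar>) \<longlongrightarrow> (\<Sum>j<N. \<bar>H $$ (i, j) / sqrt (real N) * 0\<bar>)) at_top" for i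
    unfolding b_def using lim L
    by (intro tendsto_sum tendsto_rabs tendsto_mult tendsto_const gain_times_sech_sq_tendsto_0) auto
  then have "\<forall>\<^sub>F g in at_top. (\<Sum>j<N. \<bar>b g i j\<bar>) < 1" for i
    by (rule order_tendstoD) simp
  then have "\<forall>\<^sub>F g in at_top. \<forall>i\<in>{..<N}. (\<Sum>j<N. \<bar>b g i j\<bar>) < 1"
    by (intro eventually_ball_finite) auto
  then show ?thesis
  proof eventually_elim
    case (elim g)
    let ?J = "map_mat complex_of_real (jacobian N H g (x g))"
    have dim: "jacobian N H g (x g) \<in> carrier_mat N N"
      using H by (intro carrier_matI) (simp_all add: jacobian_def mat_diag_dim)
    have entry: "?J $$ (i, j) + (if i = j then 1 else 0) = complex_of_real (b g i j)"
      if "i < N" "j < N" for i j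
      using that dim by (simp add: jacobian_index[OF H] b_def)
    have "Re k < 0" if "eigenvalue ?J k" for k
      using _ _ that
    proof (rule eigenvalue_Re_neg)
      show "?J \<in> carrier_mat N N" using dim by simp
      fix i assume i: "i < N"
      have "(\<Sum>j<N. cmod (?J $$ (i, j) + (if i = j then 1 else 0))) = (\<Sum>j<N. \<bar>b g i j\<bar>)"
        using i by (intro sum.cong) (simp_all only: entry norm_of_real lessThan_iff)
      then show "(\<Sum>j<N. cmod (?J $$ (i, j) + (if i = j then 1 else 0))) < 1"
        using elim i by simp
    qed
    then show ?case unfolding stable_at_def by blast
  qed
qed

section \<open>The connectivity matrix on cluster states\<close>

lemma conn_mat_index:
  assumes "i < p * n_C + n_I" "j < p * n_C + n_I"
  shows "conn_mat p n_C n_I \<mu> $$ (i, j) =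
    (if i < p * n_C
     then if j < p * n_C then if i div p = j div p \<and> i \<noteq> j then real n_C * \<mu> else 0
          else - alpha p n_C n_I * \<mu>
     else if j < p * n_C then \<mu> else if i = j then 0 else - alpha p n_C n_I * \<mu>)"
proof -
  have dim: "dim_row (exc_block p n_C \<mu>) = p * n_C" "dim_col (exc_block p n_C \<mu>) = p * n_C"
    by (simp_all add: exc_block_def dim_diag_block_mat sum_list_replicate K_mat_def ones_mat_def)
  show ?thesis
    using assms unfolding conn_mat_def
    by (subst index_mat_four_block)
       (auto simp: dim exc_block_index K_mat_def ones_mat_def)
qed

lemma sum_div_blocks:
  fixes h :: "nat \<Rightarrow> real"
  assumes "p > 0"
  shows "(\<Sum>k<p * n. h (k div p)) = real p * (\<Sum>c<n. h c)"
proof -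
  have "(\<Sum>k<p * n. h (k div p)) = (\<Sum>c<n. \<Sum>k = c * p..<c * p + p. h (k div p))"
    unfolding sum.nat_group by (simp add: mult.commute)
  also have "\<dots> = (\<Sum>c<n. \<Sum>k = c * p..<c * p + p. h c)"
  proof (intro sum.cong refl)
    fix c k assume "k \<in> {c * p..<c * p + p}"
    then have "k div p = c"
      by (intro div_nat_eqI) (auto simp: mult.commute)
    then show "h (k div p) = h c" by simp
  qed
  finally show ?thesis by (simp add: sum_distrib_left)
qed

lemma sum_two_values:
  fixes u v :: real
  assumes "C \<subseteq> {..<n}"
  shows "(\<Sum>c<n. if c \<in> C then u else v) = real (card C) * u + real (n - card C) * v"
proof -
  have "{..<n} \<inter> {c. c \<in> C} = C" "{..<n} \<inter> - {c. c \<in> C} = {..<n} - C"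
    using assms by auto
  then show ?thesis
    using assms by (simp add: sum.If_cases card_Diff_subset finite_subset)
qed

lemma sum_lessThan_add:
  fixes h :: "nat \<Rightarrow> real"
  shows "(\<Sum>k<m + n. h k) = (\<Sum>k<m. h k) + (\<Sum>k<n. h (m + k))"
  by (induction n) simp_all

text \<open>Cells of the same group receive the same total input, so cluster states are preserved.
  \<open>sE\<close> and \<open>sI\<close> are the summed activities of the two populations; the zero
  diagonals of the \<open>K_mat\<close> blocks turn \<open>p\<close> into \<open>p - 1\<close> and
  remove a cell's own term from \<open>sI\<close>.\<close>

lemma conn_mat_mult_cluster_state:
  assumes p: "p > 0" and C1: "C1 \<subseteq> {..<n_C}" and I1: "I1 \<subseteq> {..<n_I}"
    and s: "sI = real (card I1) * tI1 + real (n_I - card I1) * tI2"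
    and e: "sE = real p * (real (card C1) * tE1 + real (n_C - card C1) * tE2)"
  defines "\<alpha> \<equiv> alpha p n_C n_I"
  shows "conn_mat p n_C n_I \<mu> *\<^sub>v cluster_state p n_C n_I C1 I1 tE1 tE2 tI1 tI2 =
    cluster_state p n_C n_I C1 I1
      (real n_C * \<mu> * (real p - 1) * tE1 - \<alpha> * \<mu> * sI)
      (real n_C * \<mu> * (real p - 1) * tE2 - \<alpha> * \<mu> * sI)
      (\<mu> * sE - \<alpha> * \<mu> * (sI - tI1))
      (\<mu> * sE - \<alpha> * \<mu> * (sI - tI2))"
    (is "?H *\<^sub>v ?t = ?r")
proof (rule eq_vecI)
  let ?N = "p * n_C + n_I"
  have H: "?H \<in> carrier_mat ?N ?N" by (rule conn_mat_carrier)
  have t: "?t \<in> carrier_vec ?N" by (simp add: cluster_state_def)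
  show "dim_vec (?H *\<^sub>v ?t) = dim_vec ?r"
    using H by (simp add: cluster_state_def)
  define hE where "hE c = (if c \<in> C1 then tE1 else tE2)" for c
  define hI where "hI c = (if c \<in> I1 then tI1 else tI2)" for c
  have sumE: "(\<Sum>k<p * n_C. hE (k div p)) = sE"
    unfolding e hE_def[abs_def] sum_two_values[OF C1, symmetric] by (rule sum_div_blocks[OF p])
  have sumI: "(\<Sum>k<n_I. hI k) = sI"
    unfolding hI_def sum_two_values[OF I1] s ..
  fix i assume "i < dim_vec ?r"
  then have i: "i < ?N" by (simp add: cluster_state_def)
  have "(?H *\<^sub>v ?t) $ i = (\<Sum>k<?N. ?H $$ (i, k) * ?t $ k)"
    using H t i by (simp add: scalar_prod_def atLeast0LessThan)
  also have "\<dots> = (\<Sum>k<p * n_C. ?H $$ (i, k) * hE (k div p)) +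
      (\<Sum>k<n_I. ?H $$ (i, p * n_C + k) * hI k)"
    unfolding sum_lessThan_add by (simp add: cluster_state_def hE_def hI_def)
  also have "\<dots> = ?r $ i"
  proof (cases "i < p * n_C")
    case True
    let ?c = "i div p"
    have c: "?c < n_C" using True p by (simp add: less_mult_imp_div_less mult.commute)
    \<comment> \<open>A row of \<open>A\<close> is the indicator of the cell's own cluster minus the
      indicator of the cell itself.\<close>
    have "(\<Sum>k<p * n_C. ?H $$ (i, k) * hE (k div p)) =
        (\<Sum>k<p * n_C. real n_C * \<mu> * ((if k div p = ?c then hE ?c else 0) - (if k = i then hE ?c else 0)))"
      using True by (intro sum.cong) (auto simp: conn_mat_index)
    also have "\<dots> = real n_C * \<mu> * (real p * hE ?c - hE ?c)"
      using True c sum_div_blocks[OF p, of "\<lambda>d. if d = ?c then hE ?c else 0"]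
      by (simp add: sum_distrib_left[symmetric] sum_subtractf)
    finally have exc: "(\<Sum>k<p * n_C. ?H $$ (i, k) * hE (k div p)) =
      real n_C * \<mu> * (real p - 1) * hE ?c" by (simp add: algebra_simps)
    have "(\<Sum>k<n_I. ?H $$ (i, p * n_C + k) * hI k) = (\<Sum>k<n_I. - \<alpha> * \<mu> * hI k)"
      using True by (intro sum.cong) (simp_all add: conn_mat_index \<alpha>_def)
    also have "\<dots> = - \<alpha> * \<mu> * sI"
      unfolding sum_distrib_left[symmetric] sumI ..
    finally show ?thesis
      using True unfolding exc by (simp add: cluster_state_def hE_def)
  next
    case False
    let ?d = "i - p * n_C"
    have d: "?d < n_I" using i False by linarith
    have "(\<Sum>k<p * n_C. ?H $$ (i, k) * hE (k div p)) = (\<Sum>k<p * n_C. \<mu> * hE (k div p))"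
      using False i by (intro sum.cong) (simp_all add: conn_mat_index)
    also have "\<dots> = \<mu> * sE"
      unfolding sum_distrib_left[symmetric] sumE ..
    finally have exc: "(\<Sum>k<p * n_C. ?H $$ (i, k) * hE (k div p)) = \<mu> * sE" .
    \<comment> \<open>Inhibition from the whole population, corrected by the missing
      self-coupling.\<close>
    have "(\<Sum>k<n_I. ?H $$ (i, p * n_C + k) * hI k) =
        (\<Sum>k<n_I. - \<alpha> * \<mu> * (hI k - (if k = ?d then hI ?d else 0)))"
      using False i by (intro sum.cong) (auto simp: conn_mat_index \<alpha>_def)
    also have "\<dots> = - \<alpha> * \<mu> * (sI - hI ?d)"
      using d by (simp only: sum_distrib_left[symmetric] sum_subtractf sumI) simp
    finally show ?thesis
      using False i unfolding exc by (simp add: cluster_state_def hI_def)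
  qed
  finally show "(?H *\<^sub>v ?t) $ i = ?r $ i" .
qed

text \<open>Componentwise \<open>tanh\<close> also preserves cluster states, so the equation in all
  cells collapses to four scalar ones.\<close>

lemma fixed_point_cluster_state:
  assumes "p > 0" "C1 \<subseteq> {..<n_C}" "I1 \<subseteq> {..<n_I}"
    and "sI = real (card I1) * tanh (g * xI1) + real (n_I - card I1) * tanh (g * xI2)"
    and "sE = real p * (real (card C1) * tanh (g * xE1) + real (n_C - card C1) * tanh (g * xE2))"
    and "\<alpha> = alpha p n_C n_I" and "c = 1 / sqrt (real (p * n_C + n_I))"
    and "xE1 = c * (real n_C * \<mu> * (real p - 1) * tanh (g * xE1) - \<alpha> * \<mu> * sI)"
    and "xE2 = c * (real n_C * \<mu> * (real p - 1) * tanh (g * xE2) - \<alpha> * \<mu> * sI)"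
    and "xI1 = c * (\<mu> * sE - \<alpha> * \<mu> * (sI - tanh (g * xI1)))"
    and "xI2 = c * (\<mu> * sE - \<alpha> * \<mu> * (sI - tanh (g * xI2)))"
  shows "fixed_point (p * n_C + n_I) (conn_mat p n_C n_I \<mu>) g
    (cluster_state p n_C n_I C1 I1 xE1 xE2 xI1 xI2)"
proof -
  have tanh: "map_vec tanh (g \<cdot>\<^sub>v cluster_state p n_C n_I C1 I1 xE1 xE2 xI1 xI2) =
    cluster_state p n_C n_I C1 I1 (tanh (g * xE1)) (tanh (g * xE2)) (tanh (g * xI1)) (tanh (g * xI2))"
    by (rule eq_vecI) (auto simp: cluster_state_def)
  show ?thesis
    unfolding fixed_point_def vec_field_def tanh
      conn_mat_mult_cluster_state[OF assms(1-5)] assms(6,7)[symmetric]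
    using assms(8-11) by (auto intro!: eq_vecI simp: cluster_state_def)
qed

section \<open>Consistency of the sign pattern\<close>

text \<open>Up to a positive factor the four quantities are the saturated activities of the groups
  E1, E2, I1, I2, each multiplied by its intended sign. The bounds on \<open>J1 / J2\<close> settle
  the excitatory groups, those on \<open>C1 / C2\<close> the inhibitory ones.\<close>

lemma sign_pattern:
  fixes C1 C2 J1 J2 P \<alpha> :: real
  assumes C: "1 \<le> C1" "1 \<le> C2" and J: "1 \<le> J1" "1 \<le> J2" and P: "1 < P"
    and \<beta>: "1 \<le> J1 / J2" "J1 / J2 < 2 * P - 1"
    and lower: "(2 * (J1 / J2) * (J1 + J2) - J1 / J2 - 1) / (2 * (J1 + J2) + J1 / J2 + 1) < C1 / C2"
    and upper: "C1 / C2 < (2 * (J1 / J2) * (J1 + J2) + J1 / J2 + 1) / (2 * (J1 + J2) - J1 / J2 - 1)"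
    and \<alpha>: "\<alpha> * (J1 + J2) = P * (C1 + C2)"
  shows "0 < (C1 + C2) * (P - 1) - \<alpha> * (J1 - J2)"
    and "0 < (C1 + C2) * (P - 1) + \<alpha> * (J1 - J2)"
    and "0 < \<alpha> + (P * (C1 - C2) - \<alpha> * (J1 - J2))"
    and "0 < \<alpha> - (P * (C1 - C2) - \<alpha> * (J1 - J2))"
proof -
  have J12: "J2 \<le> J1" using \<beta>(1) J by simp
  have J21: "J1 < (2 * P - 1) * J2"
    using \<beta>(2) J by (simp add: divide_less_eq)
  have n: "0 < J1 + J2" using J by simp
  have \<alpha>': "\<alpha> = P * (C1 + C2) / (J1 + J2)"
    using \<alpha> n by (simp add: eq_divide_eq)
  have \<alpha>0: "0 < \<alpha>"
    unfolding \<alpha>' using J C P by (intro divide_pos_pos mult_pos_pos) auto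
  \<comment> \<open>This is \<open>J1 / J2 + 1\<close>, a common factor of all numerators and
    denominators in the bounds on \<open>C1 / C2\<close>.\<close>
  let ?q = "(J1 + J2) / J2"
  have q: "J1 / J2 = ?q - 1" "J1 / J2 * (J1 + J2) = J1 * ?q" "J1 + J2 = J2 * ?q"
    using J by (simp add: add_divide_distrib, simp_all)
  have "2 * (J1 / J2) * (J1 + J2) - J1 / J2 - 1 = (2 * J1 - 1) * ?q"
    "2 * (J1 / J2) * (J1 + J2) + J1 / J2 + 1 = (2 * J1 + 1) * ?q"
    using q(1,2) by (simp_all only: left_diff_distrib distrib_right mult.assoc mult_1)
  moreover have "2 * (J1 + J2) + J1 / J2 + 1 = (2 * J2 + 1) * ?q"
    "2 * (J1 + J2) - J1 / J2 - 1 = (2 * J2 - 1) * ?q"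
    using q(1,3) by (simp_all only: left_diff_distrib distrib_right mult.assoc mult_1)
  moreover have "?q \<noteq> 0" using J by simp
  ultimately have "(2 * J1 - 1) / (2 * J2 + 1) < C1 / C2" "C1 / C2 < (2 * J1 + 1) / (2 * J2 - 1)"
    using lower upper by simp_all
  then have "(2 * J1 - 1) * C2 < C1 * (2 * J2 + 1)" "C1 * (2 * J2 - 1) < (2 * J1 + 1) * C2"
    using C J by (simp_all add: pos_divide_less_eq pos_less_divide_eq)
  \<comment> \<open>Cross-multiplied, the two bounds say that \<open>2 * (C1 * J2 - C2 * J1)\<close>
    is smaller than \<open>C1 + C2\<close> in absolute value.\<close>
  then have D: "2 * (C1 * J2 - C2 * J1) < C1 + C2" "- (C1 + C2) < 2 * (C1 * J2 - C2 * J1)"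
    by (simp_all add: algebra_simps)
  show "0 < (C1 + C2) * (P - 1) - \<alpha> * (J1 - J2)"
  proof -
    \<comment> \<open>This is \<open>J1 < (2 * P - 1) * J2\<close> rearranged.\<close>
    have "P * (J1 - J2) < (P - 1) * (J1 + J2)"
      using J21 by (simp add: algebra_simps)
    then have "P * (J1 - J2) / (J1 + J2) < P - 1"
      using n by (simp add: pos_divide_less_eq)
    then have "(C1 + C2) * (P * (J1 - J2) / (J1 + J2)) < (C1 + C2) * (P - 1)"
      using C by (intro mult_strict_left_mono) auto
    moreover have "(C1 + C2) * (P * (J1 - J2) / (J1 + J2)) = \<alpha> * (J1 - J2)"
      unfolding \<alpha>' by simp
    ultimately show ?thesis by simp
  qed
  show "0 < (C1 + C2) * (P - 1) + \<alpha> * (J1 - J2)"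
    using \<alpha>0 J12 C P by (intro add_pos_nonneg mult_pos_pos mult_nonneg_nonneg) auto
  \<comment> \<open>With this scale, balance makes both \<alpha> and \<open>P\<close> multiples of
    \<open>k\<close>, and the inhibitory inequalities become \<open>D\<close> times
    \<open>k\<close>.\<close>
  define k where "k = P / (J1 + J2)"
  have k: "0 < k" "\<alpha> = k * (C1 + C2)" "P = k * (J1 + J2)"
    using P n by (simp_all add: k_def \<alpha>')
  have "P * (C1 - C2) - \<alpha> * (J1 - J2) = k * (2 * (C1 * J2 - C2 * J1))"
    unfolding k(2,3) by (simp add: algebra_simps)
  then show "0 < \<alpha> + (P * (C1 - C2) - \<alpha> * (J1 - J2))" "0 < \<alpha> - (P * (C1 - C2) - \<alpha> * (J1 - J2))"
    using mult_strict_left_mono[OF D(1) k(1)] mult_strict_left_mono[OF D(2) k(1)]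
    unfolding k(2) mult_minus_right by linarith+
qed

section \<open>The clustered fixed point and its stability\<close>

theorem mainTheorem6:
  fixes p n_C n_I n_C1 n_C2 n_I1 n_I2 :: nat
    and \<mu> \<beta>\<^sub>C \<beta> :: real
    and C1 I1 :: "nat set"
  assumes "n_C \<ge> 2" and "n_I \<ge> 2" and "p > 1"
    and "real n_C \<ge> alpha p n_C n_I" and "\<mu> > 0"
    and "n_C1 \<ge> 1" and "n_C2 \<ge> 1" and "n_C1 + n_C2 = n_C"
    and "n_I1 \<ge> 1" and "n_I2 \<ge> 1" and "n_I1 + n_I2 = n_I"
    and "\<beta>\<^sub>C = real n_C1 / real n_C2" and "\<beta>\<^sub>C \<ge> 1"
    and "\<beta> = real n_I1 / real n_I2" and "1 \<le> \<beta>" and "\<beta> < 2 * real p - 1"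
    and "(2 * \<beta> * real n_I - \<beta> - 1) / (2 * real n_I + \<beta> + 1) < \<beta>\<^sub>C"
    and "\<beta>\<^sub>C < (2 * \<beta> * real n_I + \<beta> + 1) / (2 * real n_I - \<beta> - 1)"
    and "C1 \<subseteq> {..<n_C}" and "card C1 = n_C1"
    and "I1 \<subseteq> {..<n_I}" and "card I1 = n_I1"
  shows "\<exists>(xE1 :: real \<Rightarrow> real) (xE2 :: real \<Rightarrow> real) (xI1 :: real \<Rightarrow> real) (xI2 :: real \<Rightarrow> real)
      (lE1 :: real) (lE2 :: real) (lI1 :: real) (lI2 :: real).
      (\<forall>\<^sub>F g in at_top. fixed_point (p * n_C + n_I) (conn_mat p n_C n_I \<mu>) g
         (cluster_state p n_C n_I C1 I1 (xE1 g) (xE2 g) (xI1 g) (xI2 g))) \<and>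
      (xE1 \<longlongrightarrow> lE1) at_top \<and> (xE2 \<longlongrightarrow> lE2) at_top \<and>
      (xI1 \<longlongrightarrow> lI1) at_top \<and> (xI2 \<longlongrightarrow> lI2) at_top \<and>
      lE1 > 0 \<and> lI1 > 0 \<and> lE2 < 0 \<and> lI2 < 0 \<and>
      (\<forall>\<^sub>F g in at_top. stable_at (p * n_C + n_I) (conn_mat p n_C n_I \<mu>) g
         (cluster_state p n_C n_I C1 I1 (xE1 g) (xE2 g) (xI1 g) (xI2 g)))"
proof -
  let ?s = "\<lambda>b. if b then 1 else - 1 :: real"
  let ?nC = "\<lambda>b. if b then real n_C1 else real n_C2"
  let ?nI = "\<lambda>b. if b then real n_I1 else real n_I2"
  define \<alpha> where "\<alpha> = alpha p n_C n_I"
  define c where "c = 1 / sqrt (real (p * n_C + n_I))"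
  \<comment> \<open>The system for the four activities, indexed by (excitatory?, first group?).\<close>
  define a :: "bool \<times> bool \<Rightarrow> bool \<times> bool \<Rightarrow> real" where "a = (\<lambda>(e, b) (e', b').
    c * \<mu> * (if e then if e' then if b = b' then real n_C * (real p - 1) else 0 else - \<alpha> * ?nI b'
             else if e' then real p * ?nC b' else - \<alpha> * (?nI b' - (if b = b' then 1 else 0))))"
  \<comment> \<open>The saturated activities, with \<open>tanh\<close> replaced by +1 on first
    groups and -1 on second groups; these become the limits.\<close>
  define l where "l i = (\<Sum>j\<in>UNIV. a i j * ?s (snd j))" for i
  have U: "(\<Sum>j\<in>UNIV. h j) = h (True, True) + h (True, False) + h (False, True) + h (False, False)"
    for h :: "bool \<times> bool \<Rightarrow> real"
    by (simp add: UNIV_Times_UNIV[symmetric] sum.cartesian_product[symmetric] UNIV_bool)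
  have rest: "n_C - n_C1 = n_C2" "n_I - n_I1 = n_I2"
    using assms(8,11) by simp_all
  have nC: "real n_C = real n_C1 + real n_C2"
    using assms(8) by linarith
  have \<alpha>: "\<alpha> * real n_I = real p * real n_C"
    unfolding \<alpha>_def using assms by (simp add: alpha_eq)
  have "0 < p * n_C + n_I" using assms by simp
  then have "0 < c" unfolding c_def by (simp del: of_nat_add of_nat_mult)
  then have c\<mu>: "0 < c * \<mu>" using assms by simp
  have "1 \<le> real n_C1" "1 \<le> real n_C2" "1 \<le> real n_I1" "1 \<le> real n_I2" "1 < real p"
    using assms(3,6,7,9,10) by simp_all
  note sp = sign_pattern[OF this assms(15,16)[unfolded assms(14)]
      assms(17,18)[unfolded assms(12,14) assms(11)[symmetric] of_nat_add]
      \<alpha>[folded assms(8,11), unfolded of_nat_add]]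
  have "l (True, True) =
        c * \<mu> * ((real n_C1 + real n_C2) * (real p - 1) - \<alpha> * (real n_I1 - real n_I2))"
    "l (True, False) =
        - (c * \<mu> * ((real n_C1 + real n_C2) * (real p - 1) + \<alpha> * (real n_I1 - real n_I2)))"
    "l (False, True) =
        c * \<mu> * (\<alpha> + (real p * (real n_C1 - real n_C2) - \<alpha> * (real n_I1 - real n_I2)))"
    "l (False, False) =
        - (c * \<mu> * (\<alpha> - (real p * (real n_C1 - real n_C2) - \<alpha> * (real n_I1 - real n_I2))))"
    unfolding l_def U a_def nC by (simp_all add: algebra_simps)
  then have l_signs: "0 < l (True, True)" "l (True, False) < 0" "0 < l (False, True)" "l (False, False) < 0"
    using sp c\<mu> by simp_all
  then have signs: "0 < ?s (snd j) * l j" for j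
    by (cases j) (metis (full_types) mult_1 mult_minus1 neg_0_less_iff_less snd_conv)
  obtain x where
    x: "\<forall>\<^sub>F g in at_top. \<forall>i. x g i = (\<Sum>j\<in>UNIV. a i j * tanh (g * x g j))"
    and lim: "\<And>i. ((\<lambda>g. x g i) \<longlongrightarrow> l i) at_top"
  proof (rule saturated_fixed_points[of "\<lambda>j. ?s (snd j)" l a])
    show "l i = (\<Sum>j\<in>UNIV. a i j * ?s (snd j))" for i by (rule l_def)
  qed (use signs in simp_all)
  let ?x = "\<lambda>g. cluster_state p n_C n_I C1 I1
    (x g (True, True)) (x g (True, False)) (x g (False, True)) (x g (False, False))"
  have "\<forall>\<^sub>F g in at_top. fixed_point (p * n_C + n_I) (conn_mat p n_C n_I \<mu>) g (?x g)"
    using x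
  proof eventually_elim
    case (elim g)
    have eq: "x g i = (\<Sum>j\<in>UNIV. a i j * tanh (g * x g j))" for i using elim by blast
    show ?case
    \<comment> \<open>The four \<open>refl\<close> facts instantiate \<open>sI\<close>,
      \<open>sE\<close>, \<alpha> and \<open>c\<close>; what remains is the four-dimensional
      system.\<close>
    proof (rule fixed_point_cluster_state[OF _ assms(19,21) refl refl refl refl],
        unfold assms(20,22) rest \<alpha>_def[symmetric] c_def[symmetric])
      show "0 < p" using assms(3) by simp
    qed (rule trans[OF eq], simp add: U a_def algebra_simps)+
  qed
  moreover have "\<forall>\<^sub>F g in at_top. stable_at (p * n_C + n_I) (conn_mat p n_C n_I \<mu>) g (?x g)"
  proof (rule eventually_stable_at[OF conn_mat_carrier])
    \<comment> \<open>The group of cell \<open>j\<close>; through it the limits and signs of the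
      four activities carry over to all cells.\<close>
    let ?i = "\<lambda>j. if j < p * n_C then (True, j div p \<in> C1) else (False, j - p * n_C \<in> I1)"
    fix j assume "j < p * n_C + n_I"
    then have "?x g $ j = x g (?i j)" for g
      by (simp add: cluster_state_def)
    then show "((\<lambda>g. ?x g $ j) \<longlongrightarrow> l (?i j)) at_top"
      using lim by presburger
    show "l (?i j) \<noteq> 0"
      using signs[of "?i j"] by force
  qed
  ultimately show ?thesis
    using lim l_signs
    by - (rule exI[of _ "\<lambda>g. x g (True, True)"], rule exI[of _ "\<lambda>g. x g (True, False)"],
      rule exI[of _ "\<lambda>g. x g (False, True)"], rule exI[of _ "\<lambda>g. x g (False, False)"],
      rule exI[of _ "l (True, True)"], rule exI[of _ "l (True, False)"],
      rule exI[of _ "l (False, True)"], rule exI[of _ "l (False, False)"], intro conjI)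
qed

end
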